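(* Let $G=(V,E)$ be an infinite, locally finite, connected graph without loops or multiple edges. Let $H$ be a subgraph of $G$, let $H^C$ be its complementary subgraph (so $G=H\cup H^C$), and let $x_0\in H$ be a vertex such that $x_0$ is the only vertex of $H$ that has a neighbor in $H^C$. Suppose that for every $r\ge 1$ the set $S_r(x_0)\cap H$ is non-empty and $\underline{m}^H_{+1}(r)>0$, and that $$\sum_{r=1}^\infty \frac{\overline{m}^H_{-1}(r)}{\underline{m}^H_{+1}(r)}<\infty ,$$ where $$\underline{m}^H_{+1}(r)=\min_{x\in S_r(x_0),\ x\in H}m_{+1}(x),\qquad \overline{m}^H_{-1}(r)=\max_{x\in S_r(x_0),\ x\in H}m_{-1}(x).$$ Then $G$ is stochastically incomplete.
   Context: $d(x,y)$ is the number of edges in a shortest path in $G$ from $x$ to $y$; $S_r(x_0)=\{x\in V: d(x,x_0)=r\}$. For $x\in S_r(x_0)$, $m_{\pm1}(x)=|\{y\sim x : y\in S_{r\pm1}(x_0)\}|$ is the number of neighbors of $x$ in $G$ lying in the next (respectively previous) sphere. The vertices of $H^C$ are the vertices of $G$ that are not in $H$; $x\in H$ means $x$ is a vertex of $H$, and "neighbor" means neighbor in $G$. Laplacian: $\Delta f(x)=\sum_{y\sim x}(f(x)-f(y))$ for $f:V\to\mathbf{R}$. Heat kernel: fix a vertex $o\in V$. For $r\ge 0$ let $B_r$ be the subgraph induced on the vertices at distance at most $r$ from $o$; $\mathrm{int}\,B_r$ is the set of vertices of $B_r$ all of whose neighbors in $G$ lie in $B_r$, and $\partial B_r$ is the set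 of remaining vertices of $B_r$. Let $C(B_r,\partial B_r)$ be the finite-dimensional space of real functions on $B_r$ vanishing on $\partial B_r$, and let $\Delta_r$ act on it by $\Delta_r f(x)=\Delta f(x)$ for $x\in \mathrm{int}\,B_r$ and $\Delta_r f(x)=0$ for $x \in \partial B_r$. For $t\ge 0$ put $p_t^r(x,y)=e^{-t\Delta_r}\delta_x(y)$ for $x,y\in\mathrm{int}\,B_r$ and $p_t^r(x,y)=0$ for all other pairs of vertices. The heat kernel of $G$ is $p_t(x,y)=\lim_{r\to\infty}p_t^r(x,y)$ (the limit exists and does not depend on $o$). Equivalently, $p_t(x,y)$ is the smallest non-negative function satisfying $\Delta p_t(x,y)+\frac{\partial}{\partial t}p_t(x,y)=0$ for $t \geq 0$ and $p_0(x,y)=\delta_x(y)$. One has $\sum_{y\in V}p_t(x,y)\le 1$. $G$ is stochastically incomplete if $\sum_{y\in V}p_t(x,y)<1$ for some $x\in V$ and some $t>0$. *)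

theory Defs
  imports "HOL-Analysis.Infinite_Sum"
begin

text \<open>
  Edges are two-element sets of vertices, which rules out loops and multiple edges.
\<close>

record 'a graph =
  vertices :: "'a set"
  edges :: "'a set set"

definition simple_graph :: "'a graph \<Rightarrow> bool" where
  "simple_graph G \<longleftrightarrow>
     (\<forall>e\<in>edges G. \<exists>x y. x \<in> vertices G \<and> y \<in> vertices G \<and> x \<noteq> y \<and> e = {x, y})"

definition subgraph :: "'a graph \<Rightarrow> 'a graph \<Rightarrow> bool" where
  "subgraph H G \<longleftrightarrow> simple_graph H \<and> vertices H \<subseteq> vertices G \<and> edges H \<subseteq> edges G"

definition adjacent :: "'a graph \<Rightarrow> 'a \<Rightarrow> 'a \<Rightarrow> bool" where
  "adjacent G x y \<longleftrightarrow> {x, y} \<in> edges G"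

definition neighbors :: "'a graph \<Rightarrow> 'a \<Rightarrow> 'a set" where
  "neighbors G x = {y. adjacent G x y}"

definition locally_finite :: "'a graph \<Rightarrow> bool" where
  "locally_finite G \<longleftrightarrow> (\<forall>x\<in>vertices G. finite (neighbors G x))"

text \<open>A path is given by its list of vertices, so one with \<open>n\<close> edges has length \<open>n + 1\<close>.\<close>

definition path_from_to :: "'a graph \<Rightarrow> 'a list \<Rightarrow> 'a \<Rightarrow> 'a \<Rightarrow> bool" where
  "path_from_to G xs x y \<longleftrightarrow>
     xs \<noteq> [] \<and> hd xs = x \<and> last xs = y \<and> set xs \<subseteq> vertices G \<and> successively (adjacent G) xs"

definition connected_graph :: "'a graph \<Rightarrow> bool" where
  "connected_graph G \<longleftrightarrow> (\<forall>x\<in>vertices G. \<forall>y\<in>vertices G. \<exists>xs. path_from_to G xs x y)"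

text \<open>Only meaningful if some path from \<open>x\<close> to \<open>y\<close> exists.\<close>

definition graph_dist :: "'a graph \<Rightarrow> 'a \<Rightarrow> 'a \<Rightarrow> nat" where
  "graph_dist G x y = (LEAST n. \<exists>xs. path_from_to G xs x y \<and> length xs = n + 1)"

definition graph_sphere :: "'a graph \<Rightarrow> 'a \<Rightarrow> nat \<Rightarrow> 'a set" where
  "graph_sphere G x0 r = {x \<in> vertices G. graph_dist G x x0 = r}"

definition graph_ball :: "'a graph \<Rightarrow> 'a \<Rightarrow> nat \<Rightarrow> 'a set" where
  "graph_ball G x0 r = {x \<in> vertices G. graph_dist G x x0 \<le> r}"

definition m_plus :: "'a graph \<Rightarrow> 'a \<Rightarrow> 'a \<Rightarrow> nat" where
  "m_plus G x0 x = card {y \<in> neighbors G x. y \<in> graph_sphere G x0 (graph_dist G x x0 + 1)}"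

text \<open>
  The condition is on \<open>r + 1\<close> because subtraction truncates: at \<open>x = x0\<close> the previous
  sphere is empty.
\<close>

definition m_minus :: "'a graph \<Rightarrow> 'a \<Rightarrow> 'a \<Rightarrow> nat" where
  "m_minus G x0 x =
     card {y \<in> neighbors G x. \<exists>r. graph_dist G x x0 = r + 1 \<and> y \<in> graph_sphere G x0 r}"

text \<open>
  The degrees in the next two definitions are those of \<open>G\<close>; of the subgraph \<open>H\<close> only the
  vertices matter.
\<close>

definition min_m_plus :: "'a graph \<Rightarrow> 'a graph \<Rightarrow> 'a \<Rightarrow> nat \<Rightarrow> nat" where
  "min_m_plus G H x0 r = Min (m_plus G x0 ` (graph_sphere G x0 r \<inter> vertices H))"

definition max_m_minus :: "'a graph \<Rightarrow> 'a graph \<Rightarrow> 'a \<Rightarrow> nat \<Rightarrow> nat" where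
  "max_m_minus G H x0 r = Max (m_minus G x0 ` (graph_sphere G x0 r \<inter> vertices H))"

definition laplacian :: "'a graph \<Rightarrow> ('a \<Rightarrow> real) \<Rightarrow> 'a \<Rightarrow> real" where
  "laplacian G f x = (\<Sum>y\<in>neighbors G x. f x - f y)"

definition ball_interior :: "'a graph \<Rightarrow> 'a \<Rightarrow> nat \<Rightarrow> 'a set" where
  "ball_interior G b r = {x \<in> graph_ball G b r. neighbors G x \<subseteq> graph_ball G b r}"

text \<open>
  A function on the ball that vanishes on its boundary is represented by its extension by
  zero to the whole type, i.e. by a function vanishing outside \<open>ball_interior G b r\<close>.
\<close>

definition dirichlet_laplacian :: "'a graph \<Rightarrow> 'a \<Rightarrow> nat \<Rightarrow> ('a \<Rightarrow> real) \<Rightarrow> 'a \<Rightarrow> real" where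
  "dirichlet_laplacian G b r f x = (if x \<in> ball_interior G b r then laplacian G f x else 0)"

text \<open>
  The operator exponential as a power series evaluated at \<open>y\<close>. The operators it is used for
  act on a finite-dimensional space of functions, where pointwise and norm convergence agree.
\<close>

definition operator_exp :: "(('a \<Rightarrow> real) \<Rightarrow> 'a \<Rightarrow> real) \<Rightarrow> ('a \<Rightarrow> real) \<Rightarrow> 'a \<Rightarrow> real" where
  "operator_exp A f y = (\<Sum>n. (A ^^ n) f y / fact n)"

definition dirichlet_heat_kernel :: "'a graph \<Rightarrow> 'a \<Rightarrow> nat \<Rightarrow> real \<Rightarrow> 'a \<Rightarrow> 'a \<Rightarrow> real" where
  "dirichlet_heat_kernel G b r t x y =
     (if x \<in> ball_interior G b r \<and> y \<in> ball_interior G b r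
      then operator_exp (\<lambda>f z. - t * dirichlet_laplacian G b r f z) (\<lambda>z. if z = x then 1 else 0) y
      else 0)"

text \<open>The vertex \<open>b\<close> is the centre of the exhausting balls.\<close>

definition heat_kernel :: "'a graph \<Rightarrow> 'a \<Rightarrow> real \<Rightarrow> 'a \<Rightarrow> 'a \<Rightarrow> real" where
  "heat_kernel G b t x y = lim (\<lambda>r. dirichlet_heat_kernel G b r t x y)"

text \<open>
  Summability is required explicitly because \<open>infsum\<close> is 0 on families that are not summable.
\<close>

definition stochastically_incomplete :: "'a graph \<Rightarrow> 'a \<Rightarrow> bool" where
  "stochastically_incomplete G b \<longleftrightarrow>
     (\<exists>x\<in>vertices G. \<exists>t>0. heat_kernel G b t x summable_on vertices G \<and>
        (\<Sum>\<^sub>\<infinity>y\<in>vertices G. heat_kernel G b t x y) < 1)"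

end

theory Submission
  imports Defs
begin

text \<open>
  Heat is lost at infinity as soon as there is a function \<open>w \<le> 1\<close>, positive somewhere, with
  \<open>\<Delta>w \<le> -w\<close> (\<open>stochastically_incomplete_of_subharmonic\<close>): let \<open>u(x,t)\<close> be the mass of the
  Dirichlet heat kernel of a ball. The function \<open>w(x) - exp(-t)\<close> is a subsolution of the heat
  equation wherever it is positive, and it lies below the solution \<open>1 - u\<close> at time \<open>0\<close> and on the
  boundary of the ball, so the maximum principle gives \<open>u(x,t) \<le> 1 - w(x) + exp(-t)\<close>. The bound
  does not depend on the ball, hence it passes to the heat kernel, and for large \<open>t\<close> it is less
  than \<open>1\<close> at every point where \<open>w\<close> is positive.

  On a ball, the maximum principle is replaced by an induction on powers. Since vertex degrees are
  bounded there, for \<open>c\<close> large enough the operator \<open>A = c - t\<Delta>\<close> with zero boundary values is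
  positive, and \<open>exp(-t\<Delta>) = exp(-c) exp(A)\<close>, so the heat kernel is a power series in \<open>A\<close> with
  non-negative terms. Positivity of \<open>A\<close> yields that the Dirichlet kernels increase with the ball,
  which makes their limit exist, and the comparison of \<open>A ^ n 1\<close> with \<open>w\<close>
  (\<open>killed_step_pow_one_le_barrier\<close>), with the slightly worse rate \<open>exp(-t/2)\<close> in place of
  \<open>exp(-t)\<close>.

  The function \<open>w\<close> vanishes outside \<open>H\<close>, and on \<open>H\<close> it depends only on the distance \<open>r\<close> to
  \<open>x0\<close>. It vanishes at \<open>x0\<close> too, and a vertex of \<open>H\<close> other than \<open>x0\<close> has all its neighbors in
  \<open>H\<close>; so the rest of the graph cannot spoil the inequality. At distance \<open>r \<ge> 1\<close> the inequality
  holds if \<open>w\<close> grows by the factor \<open>1 + (m\<^sub>- + 1) / m\<^sub>+\<close> from one sphere to the next, where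
  \<open>m\<^sub>-\<close> and \<open>m\<^sub>+\<close> are the extreme values on the sphere. As \<open>m\<^sub>- \<ge> 1\<close>, the summability
  hypothesis makes the product of these factors converge, and \<open>w\<close> can be normalised to be at
  most \<open>1\<close>.
\<close>

section \<open>Distances and balls\<close>

lemma adjacent_sym: "adjacent G x y \<longleftrightarrow> adjacent G y x"
  by (simp add: adjacent_def insert_commute)

lemma adjacent_vertices:
  assumes "simple_graph G" and "adjacent G x y"
  shows "x \<in> vertices G" and "y \<in> vertices G"
proof -
  from assms obtain a b where "a \<in> vertices G" "b \<in> vertices G" "{x, y} = {a, b}"
    unfolding simple_graph_def adjacent_def by blast
  then show "x \<in> vertices G" and "y \<in> vertices G"
    by (auto simp: doubleton_eq_iff)
qed

lemma graph_dist_le_path: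
  assumes "path_from_to G xs x y"
  shows "graph_dist G x y \<le> length xs - 1"
proof -
  have "length xs = (length xs - 1) + 1"
    using assms by (cases xs) (auto simp: path_from_to_def)
  then show ?thesis
    unfolding graph_dist_def using assms by (intro Least_le) blast
qed

lemma shortest_path_exists:
  assumes "connected_graph G" and "x \<in> vertices G" and "y \<in> vertices G"
  obtains xs where "path_from_to G xs x y" and "length xs = graph_dist G x y + 1"
proof -
  obtain xs where xs: "path_from_to G xs x y"
    using assms unfolding connected_graph_def by blast
  then have "length xs = (length xs - 1) + 1"
    by (cases xs) (auto simp: path_from_to_def)
  with xs have "\<exists>n xs. path_from_to G xs x y \<and> length xs = n + 1" by blast
  then have "\<exists>xs. path_from_to G xs x y \<and> length xs = graph_dist G x y + 1"
    unfolding graph_dist_def by (rule LeastI_ex)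
  with that show ?thesis by blast
qed

lemma graph_dist_self:
  assumes "x \<in> vertices G"
  shows "graph_dist G x x = 0"
  using graph_dist_le_path[of G "[x]" x x] assms by (simp add: path_from_to_def)

lemma graph_dist_neighbor_le:
  assumes "simple_graph G" and "connected_graph G" and "adjacent G x y" and "z \<in> vertices G"
  shows "graph_dist G y z \<le> graph_dist G x z + 1"
proof -
  note xy = adjacent_vertices[OF assms(1,3)]
  obtain xs where xs: "path_from_to G xs x z" and len: "length xs = graph_dist G x z + 1"
    using shortest_path_exists[OF assms(2) xy(1) assms(4)] .
  have "path_from_to G (y # xs) y z"
    using xs xy assms(3) by (cases xs) (auto simp: path_from_to_def adjacent_sym)
  from graph_dist_le_path[OF this] len show ?thesis by simp
qed

text \<open>The second vertex of a shortest path.\<close>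

lemma closer_neighbor_exists:
  assumes "connected_graph G" and "x \<in> vertices G" and "z \<in> vertices G"
    and "graph_dist G x z = Suc r"
  obtains y where "adjacent G x y" and "y \<in> vertices G" and "graph_dist G y z \<le> r"
proof -
  obtain xs where xs: "path_from_to G xs x z" and len: "length xs = graph_dist G x z + 1"
    using shortest_path_exists[OF assms(1-3)] .
  obtain y ys where ys: "xs = x # y # ys"
    using xs len assms(4)
    by (cases xs; cases "tl xs") (auto simp: path_from_to_def)
  have "path_from_to G (y # ys) y z"
    using xs ys by (auto simp: path_from_to_def)
  from graph_dist_le_path[OF this] have "graph_dist G y z \<le> r"
    using len ys assms(4) by simp
  then show ?thesis
    using that[of y] xs ys by (auto simp: path_from_to_def)
qed

lemma finite_graph_ball:
  assumes "connected_graph G" and "locally_finite G" and "z \<in> vertices G"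
  shows "finite (graph_ball G z r)"
proof (induction r)
  case 0
  have "graph_ball G z 0 \<subseteq> {z}"
  proof
    fix x assume "x \<in> graph_ball G z 0"
    then have x: "x \<in> vertices G" "graph_dist G x z = 0"
      by (auto simp: graph_ball_def)
    obtain xs where xs: "path_from_to G xs x z" and len: "length xs = graph_dist G x z + 1"
      using shortest_path_exists[OF assms(1) x(1) assms(3)] .
    then show "x \<in> {z}"
      using x by (cases xs) (auto simp: path_from_to_def)
  qed
  then show ?case by (rule finite_subset) simp
next
  case (Suc r)
  have "graph_ball G z (Suc r) \<subseteq> graph_ball G z r \<union> (\<Union>y\<in>graph_ball G z r. neighbors G y)"
  proof
    fix x assume "x \<in> graph_ball G z (Suc r)"
    then have x: "x \<in> vertices G" "graph_dist G x z \<le> Suc r"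
      by (auto simp: graph_ball_def)
    show "x \<in> graph_ball G z r \<union> (\<Union>y\<in>graph_ball G z r. neighbors G y)"
    proof (cases "graph_dist G x z \<le> r")
      case True
      with x show ?thesis by (simp add: graph_ball_def)
    next
      case False
      with x have "graph_dist G x z = Suc r" by simp
      from closer_neighbor_exists[OF assms(1) x(1) assms(3) this]
      obtain y where "adjacent G x y" "y \<in> vertices G" "graph_dist G y z \<le> r" .
      then show ?thesis
        by (auto simp: graph_ball_def neighbors_def adjacent_sym)
    qed
  qed
  moreover have "finite (\<Union>y\<in>graph_ball G z r. neighbors G y)"
    using Suc assms(2) by (auto simp: locally_finite_def graph_ball_def)
  ultimately show ?case
    using Suc by (meson finite_Un finite_subset)
qed

lemma ball_interior_mono:
  assumes "r \<le> s"
  shows "ball_interior G b r \<subseteq> ball_interior G b s"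
  using assms by (fastforce simp: ball_interior_def graph_ball_def)

section \<open>The exponential of a shifted operator\<close>

text \<open>
  If \<open>a k\<close> stands for the power \<open>A ^ k\<close>, the sums below are the expansions of \<open>(A + d) ^ n\<close>, and the
  recursion says \<open>(A + d) ^ Suc n = A (A + d) ^ n + d (A + d) ^ n\<close>. Numerical sequences are used
  because only values of operator powers at a fixed function and vertex occur.
\<close>

lemma binomial_transform_Suc:
  fixes a :: "nat \<Rightarrow> real"
  shows "(\<Sum>k\<le>Suc n. of_nat (Suc n choose k) * d ^ (Suc n - k) * a k) =
    (\<Sum>k\<le>n. of_nat (n choose k) * d ^ (n - k) * a (Suc k)) +
    d * (\<Sum>k\<le>n. of_nat (n choose k) * d ^ (n - k) * a k)"
proof -
  have "d * (\<Sum>k\<le>n. of_nat (n choose k) * d ^ (n - k) * a k) =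
      (\<Sum>k\<le>n. of_nat (n choose k) * d ^ (Suc n - k) * a k)"
    unfolding sum_distrib_left by (intro sum.cong refl) (simp add: Suc_diff_le)
  also have "\<dots> = (\<Sum>k\<le>Suc n. of_nat (n choose k) * d ^ (Suc n - k) * a k)"
    by simp
  also have "\<dots> = d ^ Suc n * a 0 +
      (\<Sum>k\<le>n. of_nat (n choose Suc k) * d ^ (n - k) * a (Suc k))"
    by (subst sum.atMost_Suc_shift) simp
  finally have *: "d * (\<Sum>k\<le>n. of_nat (n choose k) * d ^ (n - k) * a k) =
      d ^ Suc n * a 0 + (\<Sum>k\<le>n. of_nat (n choose Suc k) * d ^ (n - k) * a (Suc k))" .
  show ?thesis
    unfolding * by (subst sum.atMost_Suc_shift) (simp add: algebra_simps sum.distrib)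
qed

lemma exp_series_sums: "(\<lambda>n. x ^ n / fact n) sums exp (x :: real)"
  using exp_converges[of x] by (simp add: scaleR_conv_of_real divide_inverse mult.commute)

text \<open>In the same reading: \<open>exp (A + d) = exp d * exp A\<close>, by the Cauchy product.\<close>

lemma binomial_transform_exp_sums:
  fixes a :: "nat \<Rightarrow> real"
  assumes "summable (\<lambda>k. \<bar>a k\<bar> / fact k)"
  shows "(\<lambda>n. (\<Sum>k\<le>n. of_nat (n choose k) * d ^ (n - k) * a k) / fact n) sums
    (exp d * (\<Sum>k. a k / fact k))"
proof -
  have 1: "summable (\<lambda>k. norm (a k / fact k))"
    using assms by (simp add: abs_divide)
  have 2: "summable (\<lambda>k. norm (d ^ k / fact k))"
    using sums_summable[OF exp_series_sums[of "\<bar>d\<bar>"]] by (simp add: abs_divide power_abs)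
  have 3: "exp d = (\<Sum>k. d ^ k / fact k)"
    by (rule sums_unique[OF exp_series_sums])
  have "(\<lambda>n. \<Sum>k\<le>n. (a k / fact k) * (d ^ (n - k) / fact (n - k))) sums
      ((\<Sum>k. a k / fact k) * (\<Sum>k. d ^ k / fact k))"
    by (rule Cauchy_product_sums[OF 1 2])
  moreover have "(\<Sum>k\<le>n. (a k / fact k) * (d ^ (n - k) / fact (n - k))) =
      (\<Sum>k\<le>n. of_nat (n choose k) * d ^ (n - k) * a k) / fact n" for n
    unfolding sum_divide_distrib
    by (intro sum.cong refl) (simp add: binomial_fact field_simps)
  ultimately show ?thesis
    by (simp add: 3 mult.commute)
qed

section \<open>Powers of the shifted Dirichlet Laplacian\<close>

text \<open>
  Up to the factor \<open>c\<close>, this is one step of a lazy random walk that dies on leaving \<open>I\<close>. The time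
  \<open>t\<close> is part of the operator, so that \<open>- t * \<Delta>\<close> differs from it by the constant \<open>c\<close>.
\<close>

definition killed_step :: "'a graph \<Rightarrow> 'a set \<Rightarrow> real \<Rightarrow> real \<Rightarrow> ('a \<Rightarrow> real) \<Rightarrow> 'a \<Rightarrow> real" where
  "killed_step G I t c f x = (if x \<in> I then c * f x - t * laplacian G f x else 0)"

lemma killed_step_expand:
  assumes "x \<in> I"
  shows "killed_step G I t c f x =
    (c - t * real (card (neighbors G x))) * f x + t * (\<Sum>y\<in>neighbors G x. f y)"
  using assms by (simp add: killed_step_def laplacian_def sum_subtractf algebra_simps)

lemma killed_step_mono:
  assumes "x \<in> I" and "t * real (card (neighbors G x)) \<le> c" and "0 \<le> t" and "\<And>y. f y \<le> g y"
  shows "killed_step G I t c f x \<le> killed_step G I t c g x"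
  unfolding killed_step_expand[OF assms(1)]
  using assms by (intro add_mono mult_left_mono sum_mono) auto

lemma killed_step_nonneg:
  assumes "\<And>x. x \<in> I \<Longrightarrow> t * real (card (neighbors G x)) \<le> c" and "0 \<le> t" and "\<And>y. 0 \<le> f y"
  shows "0 \<le> killed_step G I t c f x"
proof (cases "x \<in> I")
  case True
  show ?thesis
    unfolding killed_step_expand[OF True] using assms(1)[OF True] assms(2,3)
    by (intro add_nonneg_nonneg mult_nonneg_nonneg sum_nonneg) auto
qed (simp add: killed_step_def)

lemma killed_step_pow_nonneg:
  assumes "\<And>x. x \<in> I \<Longrightarrow> t * real (card (neighbors G x)) \<le> c" and "0 \<le> t" and "\<And>y. 0 \<le> f y"
  shows "0 \<le> (killed_step G I t c ^^ n) f x"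
proof (induction n arbitrary: x)
  case (Suc n)
  show ?case
    using killed_step_nonneg[of I t G c, OF assms(1,2) Suc] by simp
qed (simp add: assms(3))

lemma killed_step_pow_vanishes:
  assumes "\<And>y. y \<notin> I \<Longrightarrow> f y = 0" and "x \<notin> I"
  shows "(killed_step G I t c ^^ n) f x = 0"
  using assms by (cases n) (auto simp: killed_step_def)

text \<open>A walk killed later carries more mass. This is what makes the Dirichlet kernels increase.\<close>

lemma killed_step_pow_mono:
  assumes "I \<subseteq> J" and "\<And>x. x \<in> J \<Longrightarrow> t * real (card (neighbors G x)) \<le> c" and "0 \<le> t"
    and "\<And>y. 0 \<le> f y" and "\<And>y. f y \<le> g y"
  shows "(killed_step G I t c ^^ n) f x \<le> (killed_step G J t c ^^ n) g x"
proof (induction n arbitrary: x)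
  case (Suc n)
  let ?u = "(killed_step G I t c ^^ n) f" and ?v = "(killed_step G J t c ^^ n) g"
  show ?case
  proof (cases "x \<in> I")
    case True
    then have "killed_step G I t c ?u x = killed_step G J t c ?u x"
      using assms(1) by (auto simp: killed_step_def)
    also have "\<dots> \<le> killed_step G J t c ?v x"
      using True assms(1-3) by (intro killed_step_mono Suc) auto
    finally show ?thesis by simp
  next
    case False
    have "0 \<le> g y" for y
      using assms(4,5) order_trans by blast
    then have "0 \<le> (killed_step G J t c ^^ Suc n) g x"
      using assms(2,3) by (intro killed_step_pow_nonneg) auto
    moreover have "(killed_step G I t c ^^ Suc n) f x = 0"
      using False by (simp add: killed_step_def)
    ultimately show ?thesis by (simp only:)
  qed
qed (simp add: assms(5))

lemma killed_step_self_adjoint: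
  assumes "finite I" and "\<And>x. x \<in> I \<Longrightarrow> finite (neighbors G x)"
    and "\<And>y. y \<notin> I \<Longrightarrow> f y = 0" and "\<And>y. y \<notin> I \<Longrightarrow> g y = 0"
  shows "(\<Sum>x\<in>I. g x * killed_step G I t c f x) = (\<Sum>x\<in>I. killed_step G I t c g x * f x)"
proof -
  have *: "(\<Sum>y\<in>neighbors G x. h y) = (\<Sum>y\<in>I. if adjacent G x y then h y else 0)"
    if "x \<in> I" "\<And>y. y \<notin> I \<Longrightarrow> h y = 0" for x and h :: "'a \<Rightarrow> real"
  proof -
    have "(\<Sum>y\<in>neighbors G x. h y) = (\<Sum>y\<in>I \<inter> neighbors G x. h y)"
      using that assms(2) by (intro sum.mono_neutral_right) auto
    also have "\<dots> = (\<Sum>y\<in>I. if y \<in> neighbors G x then h y else 0)"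
      by (rule sum.inter_restrict[OF assms(1)])
    finally show ?thesis by (simp add: neighbors_def)
  qed
  have "(\<Sum>x\<in>I. g x * (\<Sum>y\<in>I. if adjacent G x y then f y else 0)) =
      (\<Sum>x\<in>I. \<Sum>y\<in>I. if adjacent G x y then g x * f y else 0)"
    unfolding sum_distrib_left by (intro sum.cong refl) auto
  also have "\<dots> = (\<Sum>y\<in>I. \<Sum>x\<in>I. if adjacent G x y then g x * f y else 0)"
    by (rule sum.swap)
  also have "\<dots> = (\<Sum>y\<in>I. (\<Sum>x\<in>I. if adjacent G y x then g x else 0) * f y)"
    unfolding sum_distrib_right by (intro sum.cong refl) (auto simp: adjacent_sym)
  finally have "(\<Sum>x\<in>I. g x * (\<Sum>y\<in>neighbors G x. f y)) =
      (\<Sum>x\<in>I. (\<Sum>y\<in>neighbors G x. g y) * f x)"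
    using assms(3,4) by (simp add: * cong: sum.cong)
  then have "t * (\<Sum>x\<in>I. g x * (\<Sum>y\<in>neighbors G x. f y)) =
      t * (\<Sum>x\<in>I. (\<Sum>y\<in>neighbors G x. g y) * f x)" by simp
  then show ?thesis
    by (simp add: killed_step_expand algebra_simps sum.distrib sum_subtractf sum_distrib_left
        cong: sum.cong)
qed

text \<open>
  Applied to \<open>indicator {x}\<close> and \<open>indicator I\<close>, this turns the total mass of the kernel started at
  \<open>x\<close> into the value at \<open>x\<close> of the power applied to the constant \<open>1\<close>, which can be bounded pointwise.
\<close>

lemma killed_step_pow_self_adjoint:
  assumes "finite I" and "\<And>x. x \<in> I \<Longrightarrow> finite (neighbors G x)"
    and "\<And>y. y \<notin> I \<Longrightarrow> f y = 0" and "\<And>y. y \<notin> I \<Longrightarrow> g y = 0"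
  shows "(\<Sum>x\<in>I. g x * (killed_step G I t c ^^ n) f x) =
    (\<Sum>x\<in>I. (killed_step G I t c ^^ n) g x * f x)"
  using assms(4)
proof (induction n arbitrary: g)
  case (Suc n)
  have "(\<Sum>x\<in>I. g x * (killed_step G I t c ^^ Suc n) f x) =
      (\<Sum>x\<in>I. killed_step G I t c g x * (killed_step G I t c ^^ n) f x)"
    using killed_step_self_adjoint[OF assms(1,2) killed_step_pow_vanishes[of I f, OF assms(3)] Suc.prems]
    by simp
  also have "\<dots> = (\<Sum>x\<in>I. (killed_step G I t c ^^ n) (killed_step G I t c g) x * f x)"
    by (rule Suc.IH) (simp add: killed_step_def)
  finally show ?case by (simp add: funpow_swap1)
qed simp

lemma killed_step_sum:
  "killed_step G I t c (\<lambda>z. \<Sum>k\<in>K. a k * f k z) x = (\<Sum>k\<in>K. a k * killed_step G I t c (f k) x)"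
proof -
  have "laplacian G (\<lambda>z. \<Sum>k\<in>K. a k * f k z) x = (\<Sum>k\<in>K. a k * laplacian G (f k) x)"
    unfolding laplacian_def sum_distrib_left right_diff_distrib sum_subtractf[symmetric]
    by (rule sum.swap)
  then show ?thesis
    by (cases "x \<in> I")
      (simp_all add: killed_step_def right_diff_distrib sum_subtractf sum_distrib_left mult.left_commute)
qed

text \<open>
  The operators \<open>- t * \<Delta>\<close> and \<open>killed_step\<close> minus \<open>c\<close> agree only on functions that vanish outside the
  interior of the ball, hence the condition on \<open>f\<close>; it is preserved by taking powers.
\<close>

lemma dirichlet_power_expand:
  assumes "\<And>y. y \<notin> ball_interior G b r \<Longrightarrow> f y = 0"
  shows "((\<lambda>f z. - t * dirichlet_laplacian G b r f z) ^^ n) f y =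
    (\<Sum>k\<le>n. of_nat (n choose k) * (- c) ^ (n - k) *
      (killed_step G (ball_interior G b r) t c ^^ k) f y)"
proof (induction n arbitrary: y)
  case (Suc n)
  let ?A = "killed_step G (ball_interior G b r) t c"
  let ?B = "\<lambda>f z. - t * dirichlet_laplacian G b r f z"
  have "((?B ^^ Suc n) f) y = ?A ((?B ^^ n) f) y - c * (?B ^^ n) f y"
  proof (cases "y \<in> ball_interior G b r")
    case False
    then have "(?B ^^ n) f y = 0"
      unfolding Suc.IH using assms by (simp add: killed_step_pow_vanishes)
    with False show ?thesis by (simp add: dirichlet_laplacian_def killed_step_def)
  qed (simp add: dirichlet_laplacian_def killed_step_def)
  also have "?A ((?B ^^ n) f) y = ?A (\<lambda>z. \<Sum>k\<le>n. (of_nat (n choose k) * (- c) ^ (n - k)) *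
      (?A ^^ k) f z) y"
    using Suc.IH by presburger
  also have "\<dots> = (\<Sum>k\<le>n. of_nat (n choose k) * (- c) ^ (n - k) * (?A ^^ Suc k) f y)"
    unfolding killed_step_sum by simp
  finally show ?case
    unfolding Suc.IH binomial_transform_Suc by simp
qed simp

section \<open>Comparison with a subharmonic function\<close>

lemma killed_step_pow_one_le:
  assumes deg: "\<And>x. x \<in> I \<Longrightarrow> t * real (card (neighbors G x)) \<le> c" and "0 \<le> t" and "0 \<le> c"
  shows "(killed_step G I t c ^^ n) (indicator I) x \<le> c ^ n"
proof (induction n arbitrary: x)
  case (Suc n)
  show ?case
  proof (cases "x \<in> I")
    case True
    have "killed_step G I t c ((killed_step G I t c ^^ n) (indicator I)) x \<le>
        killed_step G I t c (\<lambda>_. c ^ n) x"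
      using True assms by (intro killed_step_mono Suc) auto
    also have "\<dots> = c ^ Suc n"
      using True by (simp add: killed_step_def laplacian_def)
    finally show ?thesis by simp
  qed (use \<open>0 \<le> c\<close> in \<open>simp add: killed_step_def\<close>)
qed (simp add: indicator_def)

text \<open>
  The discrete maximum principle. Divided by \<open>c ^ n\<close>, the claim is that \<open>w\<close> is at most
  \<open>k ^ (-n)\<close> plus the probability of having died within \<open>n\<close> steps, with \<open>k = (c + t) / c\<close>. One step
  of the walk without killing multiplies \<open>w\<close> by at least \<open>k\<close>, so the induction hypothesis
  bounds \<open>k * w\<close> by \<open>k ^ (-n)\<close> plus the probability of having died within \<open>n + 1\<close> steps; dividing
  by \<open>k \<ge> 1\<close> does not increase that probability because it is non-negative.
\<close>

lemma killed_step_pow_one_le_barrier: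
  assumes deg: "\<And>x. x \<in> I \<Longrightarrow> t * real (card (neighbors G x)) \<le> c"
    and "0 \<le> t" and "0 < c"
    and w: "\<And>x. w x \<le> 1"
    and sub: "\<And>x. x \<in> I \<Longrightarrow> laplacian G w x \<le> - w x"
  shows "(killed_step G I t c ^^ n) (indicator I) x \<le> (c * c / (c + t)) ^ n + c ^ n * (1 - w x)"
proof (induction n arbitrary: x)
  case (0 x)
  then show ?case
    using w[of x] by (cases "x \<in> I") simp_all
next
  case (Suc n)
  let ?q = "c * c / (c + t)"
  let ?a = "\<lambda>n. (killed_step G I t c ^^ n) (indicator I)"
  have q: "0 \<le> ?q" using assms(2,3) by simp
  show ?case
  proof (cases "x \<in> I")
    case True
    have "?a (Suc n) x \<le> killed_step G I t c (\<lambda>y. ?q ^ n + c ^ n * (1 - w y)) x"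
      using True assms killed_step_mono[OF True deg[OF True] \<open>0 \<le> t\<close> Suc] by simp
    also have "\<dots> = c * ?q ^ n + c ^ Suc n * (1 - w x) + t * c ^ n * laplacian G w x"
      using True
      by (simp add: killed_step_def laplacian_def algebra_simps sum_subtractf sum_distrib_left)
    also have "\<dots> \<le> c * ?q ^ n + c ^ Suc n * (1 - w x) + t * c ^ n * (- w x)"
      using sub[OF True] assms(2,3) by (intro add_left_mono mult_left_mono) auto
    \<comment> \<open>The induction step for \<open>(c + t) / c * w\<close>; the excess factor is divided out next.\<close>
    finally have "c ^ n * ((c + t) * w x) \<le> c * ?q ^ n + (c ^ Suc n - ?a (Suc n) x)"
      by (simp add: algebra_simps)
    then have "c / (c + t) * (c ^ n * ((c + t) * w x)) \<le>
        c / (c + t) * (c * ?q ^ n + (c ^ Suc n - ?a (Suc n) x))"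
      using assms(2,3) by (intro mult_left_mono) auto
    also have "\<dots> = ?q ^ Suc n + c / (c + t) * (c ^ Suc n - ?a (Suc n) x)"
      using assms(2,3) by (simp add: algebra_simps)
    also have "\<dots> \<le> ?q ^ Suc n + 1 * (c ^ Suc n - ?a (Suc n) x)"
    proof (intro add_left_mono mult_right_mono)
      show "c / (c + t) \<le> 1" using assms(2,3) by simp
      show "0 \<le> c ^ Suc n - ?a (Suc n) x"
        using killed_step_pow_one_le[of I t G c "Suc n" x, OF deg] assms(2,3) by auto
    qed
    also have "c / (c + t) * (c ^ n * ((c + t) * w x)) = c ^ Suc n * w x"
      using assms(2,3) by simp
    finally show ?thesis by (simp add: algebra_simps)
  next
    case False
    have "0 \<le> ?q ^ Suc n + c ^ Suc n * (1 - w x)"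
      using w[of x] assms(3)
      by (intro add_nonneg_nonneg mult_nonneg_nonneg zero_le_power q) auto
    with False show ?thesis by (simp add: killed_step_def)
  qed
qed

section \<open>Dirichlet heat kernels\<close>

lemma dirichlet_heat_kernel_series:
  fixes G :: "'a graph" and b :: 'a
  defines "I \<equiv> \<lambda>r. ball_interior G b r"
  assumes deg: "\<And>x. x \<in> I r \<Longrightarrow> t * real (card (neighbors G x)) \<le> c" and "0 \<le> t" and "0 \<le> c"
    and x: "x \<in> I r" and y: "y \<in> I r"
  shows "(\<lambda>n. exp (- c) * ((killed_step G (I r) t c ^^ n) (indicator {x}) y / fact n)) sums
    dirichlet_heat_kernel G b r t x y"
proof -
  let ?A = "\<lambda>n. (killed_step G (I r) t c ^^ n) (indicator {x}) y"
  have nonneg: "0 \<le> ?A n" for n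
    using deg \<open>0 \<le> t\<close> by (intro killed_step_pow_nonneg) auto
  have "?A n \<le> (killed_step G (I r) t c ^^ n) (indicator (I r)) y" for n
    using deg \<open>0 \<le> t\<close> x by (intro killed_step_pow_mono) (auto simp: indicator_def)
  then have le: "?A n \<le> c ^ n" for n
    using killed_step_pow_one_le[of "I r" t G c n y, OF deg] assms(3,4) order_trans by blast
  have summ: "summable (\<lambda>n. ?A n / fact n)"
    by (rule summable_comparison_test'[OF sums_summable[OF exp_series_sums[of c]], of 0])
      (use le nonneg in \<open>simp add: divide_right_mono\<close>)
  have ind: "(\<lambda>z. if z = x then 1 else 0 :: real) = indicator {x}"
    by (auto simp: indicator_def fun_eq_iff)
  have "dirichlet_heat_kernel G b r t x y =
      (\<Sum>n. (\<Sum>k\<le>n. of_nat (n choose k) * (- c) ^ (n - k) * ?A k) / fact n)"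
    using x y unfolding dirichlet_heat_kernel_def operator_exp_def ind I_def
    by (subst dirichlet_power_expand[where c = c]) (auto simp: indicator_def)
  also have "\<dots> = exp (- c) * (\<Sum>n. ?A n / fact n)"
    by (rule sums_unique[symmetric, OF binomial_transform_exp_sums])
      (use summ nonneg in simp)
  finally show ?thesis
    using sums_mult[OF summable_sums[OF summ]] by simp
qed

lemma finite_ball_interior:
  assumes "connected_graph G" and "locally_finite G" and "b \<in> vertices G"
  shows "finite (ball_interior G b r)"
  by (rule finite_subset[OF _ finite_graph_ball[OF assms, of r]]) (auto simp: ball_interior_def)

lemma finite_neighbors_ball_interior:
  assumes "locally_finite G" and "x \<in> ball_interior G b r"
  shows "finite (neighbors G x)"
  using assms by (auto simp: ball_interior_def graph_ball_def locally_finite_def)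

text \<open>
  The bound \<open>t \<le> c\<close> is asked for because it keeps the decay rate \<open>c * t / (c + t)\<close>, which arises
  in the comparison, at least \<open>t / 2\<close> on every ball.
\<close>

lemma uniform_rate_exists:
  assumes "finite I" and "0 < t"
  obtains c where "t \<le> c" and "\<And>x. x \<in> I \<Longrightarrow> t * real (card (neighbors G x)) \<le> c"
proof
  let ?S = "\<Sum>x\<in>I. real (card (neighbors G x))"
  have S: "real (card (neighbors G x)) \<le> ?S" if "x \<in> I" for x
    using assms(1) that by (intro member_le_sum) auto
  show "t \<le> t * (1 + ?S)"
    using assms(2) by (simp add: sum_nonneg)
  show "t * real (card (neighbors G x)) \<le> t * (1 + ?S)" if "x \<in> I" for x
    using S[OF that] assms(2) by (intro mult_left_mono) auto
qed

text \<open>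
  A constant \<open>c\<close> suited to the larger ball also suits the smaller one, so that the two series can be
  compared term by term.
\<close>

lemma dirichlet_heat_kernel_mono:
  assumes G: "connected_graph G" "locally_finite G" "b \<in> vertices G" and "0 < t" and "r \<le> s"
  shows "0 \<le> dirichlet_heat_kernel G b s t x y"
    and "dirichlet_heat_kernel G b r t x y \<le> dirichlet_heat_kernel G b s t x y"
proof -
  let ?I = "\<lambda>r. ball_interior G b r"
  obtain c where c: "t \<le> c" and deg: "\<And>x. x \<in> ?I s \<Longrightarrow> t * real (card (neighbors G x)) \<le> c"
    using uniform_rate_exists[OF finite_ball_interior[OF G] \<open>0 < t\<close>] by blast
  have sub: "?I r \<subseteq> ?I s" by (rule ball_interior_mono[OF \<open>r \<le> s\<close>])
  have ser: "(\<lambda>n. exp (- c) * ((killed_step G (?I q) t c ^^ n) (indicator {x}) y / fact n)) sums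
      dirichlet_heat_kernel G b q t x y"
    if "?I q \<subseteq> ?I s" "x \<in> ?I q" "y \<in> ?I q" for q
    using that deg c \<open>0 < t\<close> by (intro dirichlet_heat_kernel_series) auto
  have pos: "0 \<le> (killed_step G (?I s) t c ^^ n) (indicator {x}) y" for n
    using deg \<open>0 < t\<close> by (intro killed_step_pow_nonneg) auto
  show nonneg: "0 \<le> dirichlet_heat_kernel G b s t x y"
  proof (cases "x \<in> ?I s \<and> y \<in> ?I s")
    case True
    then show ?thesis
      using pos by (intro sums_le[OF _ sums_zero ser]) auto
  qed (auto simp: dirichlet_heat_kernel_def)
  show "dirichlet_heat_kernel G b r t x y \<le> dirichlet_heat_kernel G b s t x y"
  proof (cases "x \<in> ?I r \<and> y \<in> ?I r")
    case True
    have "(killed_step G (?I r) t c ^^ n) (indicator {x}) y \<le>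
        (killed_step G (?I s) t c ^^ n) (indicator {x}) y" for n
      using sub deg \<open>0 < t\<close> by (intro killed_step_pow_mono) auto
    then show ?thesis
      using True sub by (intro sums_le[OF _ ser ser]) (auto intro!: divide_right_mono)
  next
    case False
    then have "dirichlet_heat_kernel G b r t x y = 0"
      by (auto simp: dirichlet_heat_kernel_def)
    with nonneg show ?thesis by simp
  qed
qed

text \<open>
  Summing the comparison over the exponential series gives
  \<open>exp (-c) * (exp q + exp c * (1 - w x))\<close> with \<open>q = c\<^sup>2 / (c + t)\<close>, and \<open>q - c \<le> - t / 2\<close>. The bound
  is uniform in the radius.
\<close>

lemma dirichlet_heat_kernel_mass_le:
  assumes G: "connected_graph G" "locally_finite G" "b \<in> vertices G" and t: "0 < t"
    and w: "\<And>x. w x \<le> 1"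
    and sub: "\<And>x. x \<in> vertices G \<Longrightarrow> laplacian G w x \<le> - w x"
    and "finite F"
  shows "(\<Sum>y\<in>F. dirichlet_heat_kernel G b r t x y) \<le> 1 - w x + exp (- t / 2)"
proof -
  let ?I = "ball_interior G b r" and ?p = "dirichlet_heat_kernel G b r t x"
  have finI: "finite ?I" by (rule finite_ball_interior[OF G])
  have out: "?p y = 0" if "y \<notin> ?I" for y
    using that by (simp add: dirichlet_heat_kernel_def)
  have "sum ?p F = sum ?p (F \<inter> ?I)"
    using out \<open>finite F\<close> by (intro sum.mono_neutral_right) auto
  also have "\<dots> \<le> sum ?p ?I"
    using dirichlet_heat_kernel_mono(1)[OF G t order_refl] finI by (intro sum_mono2) auto
  also have "\<dots> \<le> 1 - w x + exp (- t / 2)"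
  proof (cases "x \<in> ?I")
    case False
    then have "sum ?p ?I = 0" by (simp add: dirichlet_heat_kernel_def)
    also have "0 \<le> 1 - w x + exp (- t / 2)"
      using w[of x] by (simp add: add_nonneg_nonneg)
    finally show ?thesis .
  next
    case True
    obtain c where c: "t \<le> c" and deg: "\<And>x. x \<in> ?I \<Longrightarrow> t * real (card (neighbors G x)) \<le> c"
      using uniform_rate_exists[OF finI t] by blast
    let ?A = "killed_step G ?I t c" and ?q = "c * c / (c + t)"
    note fin = finite_neighbors_ball_interior[OF G(2)]
    have "(\<lambda>n. \<Sum>y\<in>?I. exp (- c) * ((?A ^^ n) (indicator {x}) y / fact n)) sums sum ?p ?I"
      using True deg c t by (intro sums_sum dirichlet_heat_kernel_series) auto
    moreover have "(\<Sum>y\<in>?I. exp (- c) * ((?A ^^ n) (indicator {x}) y / fact n)) =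
        exp (- c) * ((?A ^^ n) (indicator ?I) x / fact n)" for n
    proof -
      have "(\<Sum>y\<in>?I. (?A ^^ n) (indicator {x}) y) =
          (\<Sum>y\<in>?I. indicator ?I y * (?A ^^ n) (indicator {x}) y)"
        by (intro sum.cong) auto
      also have "\<dots> = (\<Sum>y\<in>?I. (?A ^^ n) (indicator ?I) y * indicator {x} y)"
        using True by (intro killed_step_pow_self_adjoint finI fin) (auto simp: indicator_def)
      also have "\<dots> = (?A ^^ n) (indicator ?I) x"
        using True finI by (simp add: indicator_def)
      finally show ?thesis
        by (simp flip: sum_distrib_left sum_divide_distrib)
    qed
    ultimately have mass: "(\<lambda>n. exp (- c) * ((?A ^^ n) (indicator ?I) x / fact n)) sums sum ?p ?I"
      by simp
    have barrier: "(\<lambda>n. exp (- c) * (?q ^ n / fact n + c ^ n / fact n * (1 - w x))) sums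
        (exp (- c) * (exp ?q + exp c * (1 - w x)))"
      by (intro sums_mult sums_add sums_mult2 exp_series_sums)
    have term_le: "(?A ^^ n) (indicator ?I) x / fact n \<le>
        ?q ^ n / fact n + c ^ n / fact n * (1 - w x)" for n
    proof -
      have "(?A ^^ n) (indicator ?I) x \<le> ?q ^ n + c ^ n * (1 - w x)"
        using c t w sub deg
        by (intro killed_step_pow_one_le_barrier)
          (auto simp: ball_interior_def graph_ball_def)
      then have "(?A ^^ n) (indicator ?I) x / fact n \<le> (?q ^ n + c ^ n * (1 - w x)) / fact n"
        by (rule divide_right_mono) simp
      then show ?thesis by (simp add: add_divide_distrib)
    qed
    have "sum ?p ?I \<le> exp (- c) * (exp ?q + exp c * (1 - w x))"
      by (rule sums_le[OF mult_left_mono[OF term_le] mass barrier]) simp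
    also have "\<dots> = exp (?q - c) + (1 - w x)"
      by (simp add: algebra_simps exp_diff exp_minus field_simps)
    also have "?q - c \<le> - t / 2"
    proof -
      have "c - ?q = c * t / (c + t)"
        using c t by (simp add: field_simps)
      also have "t / 2 \<le> \<dots>"
        using c t by (simp add: field_simps mult_left_mono)
      finally show ?thesis by simp
    qed
    finally show ?thesis by simp
  qed
  finally show ?thesis .
qed

text \<open>
  The uniform bound holds for sums over finite sets, which commute with the limit of growing balls;
  the heat kernel is then summable because it is non-negative.
\<close>

lemma stochastically_incomplete_of_subharmonic:
  assumes G: "connected_graph G" "locally_finite G" "b \<in> vertices G"
    and w: "\<And>x. w x \<le> 1"
    and sub: "\<And>x. x \<in> vertices G \<Longrightarrow> laplacian G w x \<le> - w x"
    and x: "x \<in> vertices G" "0 < w x"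
  shows "stochastically_incomplete G b"
proof -
  \<comment> \<open>A time after which \<open>exp (- t / 2)\<close> has dropped below \<open>w x\<close>; the \<open>1\<close> gives strict inequality.\<close>
  define t where "t = 2 * (1 - ln (w x))"
  have "ln (w x) \<le> 0" using x w[of x] by simp
  then have t: "0 < t" by (simp add: t_def)
  have "exp (- t / 2) = exp (ln (w x) - 1)" by (simp add: t_def)
  also have "\<dots> < exp (ln (w x))" by simp
  finally have small: "exp (- t / 2) < w x" using x by simp
  let ?B = "1 - w x + exp (- t / 2)" and ?p = "\<lambda>r. dirichlet_heat_kernel G b r t x"
  have mass: "sum (?p r) F \<le> ?B" if "finite F" for F r
    by (rule dirichlet_heat_kernel_mass_le[OF G t w sub that])
  have conv: "(\<lambda>r. ?p r y) \<longlonglongrightarrow> heat_kernel G b t x y" for y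
  proof -
    have "convergent (\<lambda>r. ?p r y)"
    proof (rule Bseq_mono_convergent)
      show "Bseq (\<lambda>r. ?p r y)"
        using mass[of "{y}"] dirichlet_heat_kernel_mono(1)[OF G t order_refl]
        by (intro BseqI'[of _ ?B]) simp
      show "\<forall>m n. m \<le> n \<longrightarrow> ?p m y \<le> ?p n y"
        using dirichlet_heat_kernel_mono(2)[OF G t] by blast
    qed
    then show ?thesis
      unfolding heat_kernel_def convergent_LIMSEQ_iff .
  qed
  have nonneg: "0 \<le> heat_kernel G b t x y" for y
    using dirichlet_heat_kernel_mono(1)[OF G t order_refl]
    by (intro LIMSEQ_le_const[OF conv]) auto
  have bound: "sum (heat_kernel G b t x) F \<le> ?B" if "finite F" for F
    using mass[OF that] by (intro LIMSEQ_le_const2[OF tendsto_sum[OF conv]]) auto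
  have summ: "heat_kernel G b t x summable_on vertices G"
    using nonneg bound by (intro nonneg_bdd_above_summable_on bdd_aboveI[of _ ?B]) auto
  have "(\<Sum>\<^sub>\<infinity>y\<in>vertices G. heat_kernel G b t x y) \<le> ?B"
    using bound by (intro infsum_le_finite_sums[OF summ]) auto
  with small have "(\<Sum>\<^sub>\<infinity>y\<in>vertices G. heat_kernel G b t x y) < 1" by simp
  with summ t x(1) show ?thesis
    unfolding stochastically_incomplete_def by blast
qed

section \<open>A radial subharmonic function\<close>

lemma prod_one_plus_le_exp_suminf:
  fixes a :: "nat \<Rightarrow> real"
  assumes "summable a" and "\<And>k. 0 \<le> a k"
  shows "(\<Prod>k<n. 1 + a k) \<le> exp (suminf a)"
proof -
  have "(\<Prod>k<n. 1 + a k) \<le> (\<Prod>k<n. exp (a k))"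
    using assms(2) by (intro prod_mono) (auto simp: add_nonneg_nonneg)
  also have "\<dots> = exp (\<Sum>k<n. a k)" by (simp add: exp_sum)
  also have "\<dots> \<le> exp (suminf a)"
    using assms by (simp add: sum_le_suminf)
  finally show ?thesis .
qed

theorem theorem3p7:
  fixes G H :: "'a graph" and x0 b :: 'a
  assumes "simple_graph G" and "infinite (vertices G)" and "locally_finite G"
    and "connected_graph G"
    and "b \<in> vertices G"
    and "subgraph H G"
    and "x0 \<in> vertices H"
    and "{x \<in> vertices H. \<exists>y \<in> vertices G - vertices H. adjacent G x y} = {x0}"
    and "\<And>r. r \<ge> 1 \<Longrightarrow> graph_sphere G x0 r \<inter> vertices H \<noteq> {}"
    and "\<And>r. r \<ge> 1 \<Longrightarrow> min_m_plus G H x0 r > 0"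
    and "summable (\<lambda>r. real (max_m_minus G H x0 (Suc r)) / real (min_m_plus G H x0 (Suc r)))"
  shows "stochastically_incomplete G b"
proof -
  have x0: "x0 \<in> vertices G" and HG: "vertices H \<subseteq> vertices G"
    using assms(6,7) by (auto simp: subgraph_def)
  define d where "d = (\<lambda>x. graph_dist G x x0)"
  define mp where "mp = (\<lambda>k. real (min_m_plus G H x0 (Suc k)))"
  define mm where "mm = (\<lambda>k. real (max_m_minus G H x0 (Suc k)))"
  have fin: "finite (graph_sphere G x0 r \<inter> vertices H)" for r
    by (rule finite_subset[OF _ finite_graph_ball[OF assms(4,3) x0, of r]])
      (auto simp: graph_sphere_def graph_ball_def)
  have finN: "finite (neighbors G x)" if "x \<in> vertices G" for x
    using that assms(3) by (simp add: locally_finite_def)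
  have mp_pos: "0 < mp k" for k
    using assms(10)[of "Suc k"] by (simp add: mp_def)
  have mp_le: "mp k \<le> real (m_plus G x0 x)" if "x \<in> vertices H" "d x = Suc k" for x k
    using that HG fin[of "Suc k"] unfolding mp_def min_m_plus_def
    by (auto intro!: Min_le simp: graph_sphere_def d_def)
  have mm_ge: "real (m_minus G x0 x) \<le> mm k" if "x \<in> vertices H" "d x = Suc k" for x k
    using that HG fin[of "Suc k"] unfolding mm_def max_m_minus_def
    by (auto intro!: Max_ge simp: graph_sphere_def d_def)
  have d_nbr: "d y \<le> d x + 1" if "adjacent G x y" for x y
    unfolding d_def by (rule graph_dist_neighbor_le[OF assms(1,4) that x0])
  \<comment> \<open>A shortest path to \<open>x0\<close> passes through the previous sphere.\<close>
  have mm_one: "1 \<le> mm k" for k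
  proof -
    obtain x where x: "x \<in> vertices H" "x \<in> vertices G" "d x = Suc k"
      using assms(9)[of "Suc k"] by (auto simp: graph_sphere_def d_def)
    from closer_neighbor_exists[OF assms(4) x(2) x0 x(3)[unfolded d_def]]
    obtain y where y: "adjacent G x y" "y \<in> vertices G" "d y \<le> k"
      unfolding d_def .
    have "d y = k"
      using y d_nbr[of y x] x by (simp add: adjacent_sym)
    then have "y \<in> {y \<in> neighbors G x. \<exists>r. graph_dist G x x0 = r + 1 \<and> y \<in> graph_sphere G x0 r}"
      using x y by (auto simp: neighbors_def graph_sphere_def d_def)
    then have "0 < m_minus G x0 x"
      unfolding m_minus_def using finN[OF x(2)] by (subst card_gt_0_iff) auto
    with mm_ge[OF x(1,3)] show ?thesis by simp
  qed
  define a where "a = (\<lambda>k. (mm k + 1) / mp k)"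
  have a_nonneg: "0 \<le> a k" for k
    using mm_one[of k] mp_pos[of k] by (simp add: a_def)
  have "summable (\<lambda>k. 2 * (mm k / mp k))"
    using assms(11) by (intro summable_mult) (simp add: mm_def mp_def)
  then have "summable a"
  proof (rule summable_comparison_test'[where N = 0])
    fix k
    have "a k \<le> 2 * (mm k / mp k)"
      using mm_one[of k] mp_pos[of k] by (simp add: a_def divide_right_mono)
    then show "norm (a k) \<le> 2 * (mm k / mp k)" using a_nonneg[of k] by simp
  qed
  define M where "M = exp (suminf a)"
  \<comment> \<open>The radial profile, divided by the bound \<open>M\<close> for all the products.\<close>
  define v where "v = (\<lambda>r. case r of 0 \<Rightarrow> 0 | Suc n \<Rightarrow> (\<Prod>k<n. 1 + a k) / M)"
  have M: "0 < M" by (simp add: M_def)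
  have v_nonneg: "0 \<le> v r" for r
    using a_nonneg M
    by (auto simp: v_def intro!: prod_nonneg add_nonneg_nonneg divide_nonneg_pos split: nat.split)
  have v_le: "v r \<le> 1" for r
    using prod_one_plus_le_exp_suminf[OF \<open>summable a\<close> a_nonneg] M
    by (auto simp: v_def M_def split: nat.split)
  have v_step: "v (Suc (Suc k)) = v (Suc k) + a k * v (Suc k)" for k
    by (simp add: v_def add_divide_distrib algebra_simps)
  define w where "w = (\<lambda>x. if x \<in> vertices H then v (d x) else 0)"
  have w_nonneg: "0 \<le> w x" for x using v_nonneg by (simp add: w_def)
  have sub: "laplacian G w x \<le> - w x" if x: "x \<in> vertices G" for x
  proof (cases "x \<in> vertices H \<and> d x \<noteq> 0")
    case False
    then have "w x = 0" by (auto simp: w_def v_def)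
    then show ?thesis using w_nonneg by (simp add: laplacian_def sum_nonneg sum_negf)
  next
    case True
    then obtain k where k: "d x = Suc k" and xH: "x \<in> vertices H"
      using not0_implies_Suc by blast
    have "x \<noteq> x0" using k graph_dist_self[OF x0] by (auto simp: d_def)
    have nH: "y \<in> vertices H" if "y \<in> neighbors G x" for y
      using assms(8) that xH \<open>x \<noteq> x0\<close> adjacent_vertices(2)[OF assms(1)]
      unfolding neighbors_def by blast
    let ?P = "{y \<in> neighbors G x. y \<in> graph_sphere G x0 (graph_dist G x x0 + 1)}"
    let ?Q = "{y \<in> neighbors G x. \<exists>r. graph_dist G x x0 = r + 1 \<and> y \<in> graph_sphere G x0 r}"
    have w_x: "w x = v (Suc k)" using xH k by (simp add: w_def)
    \<comment> \<open>Outer neighbors contribute \<open>- a k * w x\<close>, those on the same sphere nothing, inner ones at most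
      \<open>w x\<close>.\<close>
    have "laplacian G w x \<le>
        (\<Sum>y\<in>neighbors G x. (if y \<in> ?P then - (a k * w x) else 0) + (if y \<in> ?Q then w x else 0))"
      unfolding laplacian_def
    proof (rule sum_mono)
      fix y assume y: "y \<in> neighbors G x"
      then have adj: "adjacent G x y" by (simp add: neighbors_def)
      have yG: "y \<in> vertices G" using adjacent_vertices(2)[OF assms(1) adj] .
      have P: "y \<in> ?P \<longleftrightarrow> d y = Suc (Suc k)" and Q: "y \<in> ?Q \<longleftrightarrow> d y = k"
        using y yG k by (auto simp: graph_sphere_def d_def)
      have wy: "w y = v (d y)" using nH[OF y] by (simp add: w_def)
      have "d y \<le> Suc (Suc k)" "k \<le> d y"
        using d_nbr[OF adj] d_nbr[of y x] adj k by (auto simp: adjacent_sym)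
      then consider "d y = Suc (Suc k)" | "d y = Suc k" | "d y = k" by linarith
      then show "w x - w y \<le>
          (if y \<in> ?P then - (a k * w x) else 0) + (if y \<in> ?Q then w x else 0)"
        unfolding P Q
        by cases (use w_x wy v_step v_nonneg[of k] in auto)
    qed
    also have "\<dots> = - (real (m_plus G x0 x) * a k * w x) + real (m_minus G x0 x) * w x"
    proof -
      have "neighbors G x \<inter> ?P = ?P" "neighbors G x \<inter> ?Q = ?Q" by auto
      then show ?thesis
        using finN[OF x]
        by (simp add: sum.distrib sum.inter_restrict[symmetric] m_plus_def m_minus_def
            del: mem_Collect_eq)
    qed
    also have "\<dots> \<le> - ((mm k + 1) * w x) + mm k * w x"
    proof -
      have "mp k * a k \<le> real (m_plus G x0 x) * a k"
        by (rule mult_right_mono[OF mp_le[OF xH k] a_nonneg])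
      then have "mm k + 1 \<le> real (m_plus G x0 x) * a k"
        using mp_pos[of k] by (simp add: a_def)
      then show ?thesis
        using mm_ge[OF xH k] w_nonneg[of x]
        by (intro add_mono) (auto intro: mult_right_mono)
    qed
    finally show ?thesis by (simp add: algebra_simps)
  qed
  obtain x where x: "x \<in> vertices H" "x \<in> vertices G" "d x = 1"
    using assms(9)[of 1] by (auto simp: graph_sphere_def d_def)
  then have w_pos: "0 < w x" using M by (simp add: w_def v_def)
  show ?thesis
  proof (rule stochastically_incomplete_of_subharmonic[OF assms(4,3,5) _ sub x(2) w_pos])
    show "w x \<le> 1" for x using v_le by (simp add: w_def)
  qed
qed

end
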